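(* Fix $1<p<\infty$, $a\ge0$ and $C<\infty$. Let $X$ be a Banach space. Assume that, for every $M,n,d\ge1$ and every $F\in\mathcal P_d(\Omega_n;\ell_2^M(X))$, $$\bigl\|G^{\mathrm{ord}}_{1,\ell_2^M(X)}F\bigr\|_{L^p(\Omega_n)}\le C\,d^a\,\|F\|_{L^p(\Omega_n;\ell_2^M(X))}.$$ Then, for every integer $k\ge1$, every $n,d\ge1$, and every $f\in\mathcal P_d(\Omega_n;X)$, $$\bigl\|G^{\mathrm{ord}}_{k,X}f\bigr\|_{L^p(\Omega_n)}\le C^k d^{ka}\,\|f\|_{L^p(\Omega_n;X)}.$$ Consequently, also $$\bigl\|G^{\mathrm{dis}}_{k,X}f\bigr\|_{L^p(\Omega_n)}\le C^k d^{ka}\,\|f\|_{L^p(\Omega_n;X)}.$$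
   Context: $\Omega_n=\{-1,1\}^n$ carries the uniform probability measure, $\varepsilon$ denotes a uniform point of $\Omega_n$, and $\|f\|_{L^p(\Omega_n;X)}=(\mathbb E_\varepsilon\|f(\varepsilon)\|_X^p)^{1/p}$. For $A\subseteq\{1,\dots,n\}$, $W_A(\varepsilon)=\prod_{j\in A}\varepsilon_j$, $W_\varnothing\equiv1$, and every $f:\Omega_n\to X$ is $f=\sum_A\widehat f(A)W_A$ with $\widehat f(A)=\mathbb E_\varepsilon W_A(\varepsilon)f(\varepsilon)\in X$. For a Banach space $X$, $\mathcal P_d(\Omega_n;X)=\{f:\Omega_n\to X:\widehat f(A)=0\text{ whenever }|A|>d\}$. The Walsh derivatives are $D_jW_A=\mathbf 1_{\{j\in A\}}W_A$, extended linearly, and $D_A=\prod_{j\in A}D_j$ (they commute). For $k\ge1$ define $$G^{\mathrm{ord}}_{k,X}f(\varepsilon)=\Bigl(\sum_{i_1,\dots,i_k=1}^n\|D_{i_1}\cdots D_{i_k}f(\varepsilon)\|_X^2\Bigr)^{1/2},\qquad G^{\mathrm{dis}}_{k,X}f(\varepsilon)=\Bigl(\sum_{A\subseteq\{1,\dots,n\},\,|A|=k}\|D_Af(\varepsilon)\|_X^2\Bigr)^{1/2}.$$ $\ell_2^M(X)$ is the direct sum of $M$ copies of $X$ with norm $\|(x_i)_{i=1}^M\|=\bigl(\sum_{i=1}^M\|x_i\|_X^2\bigr)^{1/2}$. *)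

theory Defs
  imports "HOL-Analysis.Analysis"
begin

section \<open>The direct sums \<open>\<ell>\<^sub>2\<^sup>M(X)\<close>\<close>

text \<open>
  The statement quantifies over \<open>M\<close> inside a hypothesis, so \<open>\<ell>\<^sub>2\<^sup>M(X)\<close> cannot be the type
  \<open>X ^ 'm\<close>.  Instead there is one normed type of finitely supported sequences in \<open>X\<close> with the
  \<open>\<ell>\<^sub>2\<close> norm, and \<open>\<ell>\<^sub>2\<^sup>M(X)\<close> is its subspace of sequences supported on \<open>{1..M}\<close>.
  (The norm of the library type of finitely supported maps is the \<open>\<ell>\<^sub>1\<close> norm, hence the
  separate type.)
\<close>

typedef (overloaded) 'a l2fin = "{x :: nat \<Rightarrow> 'a::zero. finite {i. x i \<noteq> 0}}"
  morphisms coord Abs_l2fin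
  by (rule exI[of _ "\<lambda>_. 0"]) simp

lemma finite_coord [simp]: "finite {i. coord x i \<noteq> 0}"
  using coord[of x] by simp

lemma coord_Abs: "finite {i. x i \<noteq> 0} \<Longrightarrow> coord (Abs_l2fin x) = x"
  by (simp add: Abs_l2fin_inverse)

lemma l2fin_eqI: "(\<And>i. coord x i = coord y i) \<Longrightarrow> x = y"
  by (metis coord_inject ext)

instantiation l2fin :: (real_vector) real_vector
begin

definition "0 = Abs_l2fin (\<lambda>_. 0)"
definition "x + y = Abs_l2fin (\<lambda>i. coord x i + coord y i)"
definition "x - y = Abs_l2fin (\<lambda>i. coord x i - coord y i)"
definition "- x = Abs_l2fin (\<lambda>i. - coord x i)"
definition "r *\<^sub>R x = Abs_l2fin (\<lambda>i. r *\<^sub>R coord x i)"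

lemma coord_zero [simp]: "coord 0 i = 0"
  by (simp add: zero_l2fin_def coord_Abs)

lemma coord_add [simp]: "coord (x + y) i = coord x i + coord y i"
proof -
  have "finite {i. coord x i + coord y i \<noteq> 0}"
    by (rule finite_subset[of _ "{i. coord x i \<noteq> 0} \<union> {i. coord y i \<noteq> 0}"]) auto
  then show ?thesis by (simp add: plus_l2fin_def coord_Abs)
qed

lemma coord_diff [simp]: "coord (x - y) i = coord x i - coord y i"
proof -
  have "finite {i. coord x i - coord y i \<noteq> 0}"
    by (rule finite_subset[of _ "{i. coord x i \<noteq> 0} \<union> {i. coord y i \<noteq> 0}"]) auto
  then show ?thesis by (simp add: minus_l2fin_def coord_Abs)
qed

lemma coord_uminus [simp]: "coord (- x) i = - coord x i"
  by (simp add: uminus_l2fin_def coord_Abs)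

lemma coord_scaleR [simp]: "coord (r *\<^sub>R x) i = r *\<^sub>R coord x i"
proof -
  have "finite {i. r *\<^sub>R coord x i \<noteq> 0}"
    by (rule finite_subset[of _ "{i. coord x i \<noteq> 0}"]) auto
  then show ?thesis by (simp add: scaleR_l2fin_def coord_Abs)
qed

instance
  by standard (rule l2fin_eqI; simp add: algebra_simps)+

end

instantiation l2fin :: (real_normed_vector) real_normed_vector
begin

definition "norm (x :: 'a l2fin) = L2_set (\<lambda>i. norm (coord x i)) {i. coord x i \<noteq> 0}"
definition "sgn (x :: 'a l2fin) = x /\<^sub>R norm x"
definition "dist (x :: 'a l2fin) y = norm (x - y)"
definition "(uniformity :: ('a l2fin \<times> 'a l2fin) filter) =
  (INF e\<in>{0<..}. principal {(x, y). dist x y < e})"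
definition "open (U :: 'a l2fin set) \<longleftrightarrow>
  (\<forall>x\<in>U. \<forall>\<^sub>F (x', y) in uniformity. x' = x \<longrightarrow> y \<in> U)"

lemma norm_l2fin_superset:
  assumes "finite S" "{i. coord x i \<noteq> 0} \<subseteq> S"
  shows "norm x = L2_set (\<lambda>i. norm (coord x i)) S"
  unfolding norm_l2fin_def L2_set_def
  by (intro arg_cong[of _ _ sqrt] sum.mono_neutral_left) (use assms in auto)

instance
proof
  fix x y :: "'a l2fin" and r :: real
  show "norm x = 0 \<longleftrightarrow> x = 0"
    by (auto simp: norm_l2fin_def L2_set_eq_0_iff intro!: l2fin_eqI)
  let ?S = "{i. coord x i \<noteq> 0} \<union> {i. coord y i \<noteq> 0}"
  have "norm (x + y) = L2_set (\<lambda>i. norm (coord x i + coord y i)) ?S"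
    by (subst norm_l2fin_superset[of ?S]) auto
  also have "\<dots> \<le> L2_set (\<lambda>i. norm (coord x i) + norm (coord y i)) ?S"
    by (rule L2_set_mono) (auto simp: norm_triangle_ineq)
  also have "\<dots> \<le> L2_set (\<lambda>i. norm (coord x i)) ?S + L2_set (\<lambda>i. norm (coord y i)) ?S"
    by (rule L2_set_triangle_ineq)
  also have "\<dots> = norm x + norm y"
    by (simp add: norm_l2fin_superset[of ?S x] norm_l2fin_superset[of ?S y])
  finally show "norm (x + y) \<le> norm x + norm y" .
  have "norm (r *\<^sub>R x) = L2_set (\<lambda>i. \<bar>r\<bar> * norm (coord x i)) {i. coord x i \<noteq> 0}"
    by (subst norm_l2fin_superset[of "{i. coord x i \<noteq> 0}"]) auto
  then show "norm (r *\<^sub>R x) = \<bar>r\<bar> * norm x"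
    by (simp add: norm_l2fin_def L2_set_right_distrib)
qed (rule sgn_l2fin_def dist_l2fin_def uniformity_l2fin_def open_l2fin_def)+

end

definition ell2 :: "nat \<Rightarrow> 'a::real_normed_vector l2fin set" where
  "ell2 M = {x. \<forall>i. i \<notin> {1..M} \<longrightarrow> coord x i = 0}"

lemma norm_ell2:
  assumes "x \<in> ell2 M"
  shows "norm x = sqrt (\<Sum>i=1..M. (norm (coord x i))\<^sup>2)"
proof -
  have "{i. coord x i \<noteq> 0} \<subseteq> {1..M}"
    using assms by (force simp: ell2_def)
  then show ?thesis
    using norm_l2fin_superset[of "{1..M}" x] by (simp add: L2_set_def)
qed

lemma ex_ell2:
  fixes u :: "nat \<Rightarrow> 'a::real_normed_vector"
  shows "\<exists>!x. x \<in> ell2 M \<and> (\<forall>i\<in>{1..M}. coord x i = u i)"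
proof -
  let ?v = "\<lambda>i. if i \<in> {1..M} then u i else 0"
  have "finite {i. ?v i \<noteq> 0}"
    by (rule finite_subset[of _ "{1..M}"]) auto
  then have "coord (Abs_l2fin ?v) = ?v"
    by (rule coord_Abs)
  then show ?thesis
    by (intro ex1I[of _ "Abs_l2fin ?v"] conjI ballI l2fin_eqI) (auto simp: ell2_def)
qed


section \<open>Walsh analysis on the discrete cube\<close>

definition cube :: "nat \<Rightarrow> (nat \<Rightarrow> real) set" where
  "cube n = {1..n} \<rightarrow>\<^sub>E {-1, 1}"

text \<open>
  Expectation under the uniform probability measure, written as a finite average because the
  Bochner integral of the library is restricted to second countable spaces.
\<close>

definition cube_avg :: "nat \<Rightarrow> ((nat \<Rightarrow> real) \<Rightarrow> 'b) \<Rightarrow> 'b::real_vector" where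
  "cube_avg n g = (\<Sum>\<epsilon>\<in>cube n. g \<epsilon>) /\<^sub>R real (card (cube n))"

definition Lp_norm :: "real \<Rightarrow> nat \<Rightarrow> ((nat \<Rightarrow> real) \<Rightarrow> 'b::real_normed_vector) \<Rightarrow> real" where
  "Lp_norm p n f = (cube_avg n (\<lambda>\<epsilon>. norm (f \<epsilon>) powr p)) powr (1 / p)"

definition walsh :: "nat set \<Rightarrow> (nat \<Rightarrow> real) \<Rightarrow> real" where
  "walsh A \<epsilon> = (\<Prod>j\<in>A. \<epsilon> j)"

definition walsh_coeff ::
    "nat \<Rightarrow> ((nat \<Rightarrow> real) \<Rightarrow> 'b) \<Rightarrow> nat set \<Rightarrow> 'b::real_vector" where
  "walsh_coeff n f A = cube_avg n (\<lambda>\<epsilon>. walsh A \<epsilon> *\<^sub>R f \<epsilon>)"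

text \<open>\<open>\<P>\<^sub>d(\<Omega>\<^sub>n; V)\<close> for a linear subspace \<open>V\<close> of the value type.\<close>

definition walsh_poly ::
    "nat \<Rightarrow> nat \<Rightarrow> 'b set \<Rightarrow> ((nat \<Rightarrow> real) \<Rightarrow> 'b::real_vector) set" where
  "walsh_poly d n V =
     {f \<in> cube n \<rightarrow> V. \<forall>A. A \<subseteq> {1..n} \<and> card A > d \<longrightarrow> walsh_coeff n f A = 0}"

definition walsh_deriv ::
    "nat \<Rightarrow> nat \<Rightarrow> ((nat \<Rightarrow> real) \<Rightarrow> 'b) \<Rightarrow> (nat \<Rightarrow> real) \<Rightarrow> 'b::real_vector" where
  "walsh_deriv n j f \<epsilon> =
     (\<Sum>A\<in>Pow {1..n}. (if j \<in> A then walsh A \<epsilon> else 0) *\<^sub>R walsh_coeff n f A)"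

text \<open>\<open>D\<^bsub>i\<^sub>1\<^esub> \<cdots> D\<^bsub>i\<^sub>k\<^esub>\<close> for the list \<open>[i\<^sub>1, \<dots>, i\<^sub>k]\<close>.\<close>

definition walsh_derivs ::
    "nat \<Rightarrow> nat list \<Rightarrow> ((nat \<Rightarrow> real) \<Rightarrow> 'b) \<Rightarrow> (nat \<Rightarrow> real) \<Rightarrow> 'b::real_vector" where
  "walsh_derivs n is f = foldr (walsh_deriv n) is f"

text \<open>The operators \<open>D\<^sub>j\<close> commute, so \<open>D\<^sub>A\<close> may be formed in increasing order of the indices.\<close>

definition walsh_deriv_set ::
    "nat \<Rightarrow> nat set \<Rightarrow> ((nat \<Rightarrow> real) \<Rightarrow> 'b) \<Rightarrow> (nat \<Rightarrow> real) \<Rightarrow> 'b::real_vector" where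
  "walsh_deriv_set n A f = walsh_derivs n (sorted_list_of_set A) f"

definition G_ord ::
    "nat \<Rightarrow> nat \<Rightarrow> ((nat \<Rightarrow> real) \<Rightarrow> 'b::real_normed_vector) \<Rightarrow> (nat \<Rightarrow> real) \<Rightarrow> real" where
  "G_ord k n f \<epsilon> =
     sqrt (\<Sum>is | length is = k \<and> set is \<subseteq> {1..n}. (norm (walsh_derivs n is f \<epsilon>))\<^sup>2)"

definition G_dis ::
    "nat \<Rightarrow> nat \<Rightarrow> ((nat \<Rightarrow> real) \<Rightarrow> 'b::real_normed_vector) \<Rightarrow> (nat \<Rightarrow> real) \<Rightarrow> real" where
  "G_dis k n f \<epsilon> =
     sqrt (\<Sum>A | A \<subseteq> {1..n} \<and> card A = k. (norm (walsh_deriv_set n A f \<epsilon>))\<^sup>2)"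

end

theory Submission
  imports Defs
begin

text \<open>
  The hypothesis bounds one gradient, but for functions with values in every \<open>\<ell>\<^sub>2\<^sup>M(X)\<close>; this is
  what allows it to be iterated.  Collect all derivatives of order \<open>k\<close> of \<open>f\<close> into the single
  function \<open>F = (D\<^bsub>i\<^sub>1\<^esub> \<cdots> D\<^bsub>i\<^sub>k\<^esub> f)\<close>, indexed by the \<open>M = n\<^sup>k\<close> words \<open>i\<^sub>1 \<dots> i\<^sub>k\<close>, with values in
  \<open>\<ell>\<^sub>2\<^sup>M(X)\<close>.  Its norm at \<open>\<epsilon>\<close> is \<open>G\<^sup>o\<^sup>r\<^sup>d\<^sub>k f(\<epsilon>)\<close>.  Walsh derivatives act coordinatewise, so the
  sum over \<open>j\<close> and over words of \<open>\<parallel>D\<^sub>j D\<^bsub>i\<^sub>1\<^esub> \<cdots> D\<^bsub>i\<^sub>k\<^esub> f(\<epsilon>)\<parallel>\<^sup>2\<close> is the square of both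
  \<open>G\<^sup>o\<^sup>r\<^sup>d\<^sub>1 F(\<epsilon>)\<close> and \<open>G\<^sup>o\<^sup>r\<^sup>d\<^bsub>k+1\<^esub> f(\<epsilon>)\<close>.  Finally, derivatives only delete Walsh coefficients, by
  orthogonality of the Walsh functions, so \<open>F\<close> still has degree at most \<open>d\<close>.  Hence each further
  derivative costs one factor \<open>C d\<^sup>a\<close>.

  The bound for \<open>G\<^sup>d\<^sup>i\<^sup>s\<close> follows because a set of \<open>k\<close> indices is one of the words, namely its
  increasing enumeration, and so \<open>G\<^sup>d\<^sup>i\<^sup>s\<^sub>k f \<le> G\<^sup>o\<^sup>r\<^sup>d\<^sub>k f\<close> pointwise.
\<close>

section \<open>Walsh coefficients of derivatives\<close>

lemma finite_cube [simp]: "finite (cube n)"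
  by (simp add: cube_def finite_PiE)

lemma card_cube: "card (cube n) = 2 ^ n"
  by (simp add: cube_def card_PiE numeral_2_eq_2)

text \<open>
  The sum over the cube of a product of functions of single coordinates factors over the
  coordinates; a coordinate in exactly one of the two sets contributes the factor \<open>-1 + 1\<close>, and
  every other coordinate the factor \<open>2\<close>.
\<close>

lemma walsh_orthonormal:
  assumes "A \<subseteq> {1..n}" "B \<subseteq> {1..n}"
  shows "cube_avg n (\<lambda>\<epsilon>. walsh A \<epsilon> * walsh B \<epsilon>) = (if A = B then 1 else 0)"
proof -
  let ?u = "\<lambda>S (j::nat) (y::real). if j \<in> S then y else 1"
  have walsh_eq: "walsh S \<epsilon> = (\<Prod>j\<in>{1..n}. ?u S j (\<epsilon> j))" if "S \<subseteq> {1..n}" for S \<epsilon>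
    using that by (simp add: walsh_def prod.inter_restrict[symmetric] Int_absorb1)
  have "(\<Sum>\<epsilon>\<in>cube n. walsh A \<epsilon> * walsh B \<epsilon>)
      = (\<Sum>\<epsilon>\<in>cube n. \<Prod>j\<in>{1..n}. ?u A j (\<epsilon> j) * ?u B j (\<epsilon> j))"
    by (simp only: walsh_eq[OF assms(1)] walsh_eq[OF assms(2)] prod.distrib)
  also have "\<dots> = (\<Prod>j\<in>{1..n}. \<Sum>y\<in>{-1,1}. ?u A j y * ?u B j y)"
    unfolding cube_def by (rule prod_sum_PiE[symmetric]) auto
  also have "\<dots> = (\<Prod>j\<in>{1..n}. if j \<in> A \<longleftrightarrow> j \<in> B then 2 else 0)"
    by (intro prod.cong) auto
  also have "\<dots> = (if A = B then 2 ^ n else 0)"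
  proof (cases "A = B")
    case False
    then obtain j where "j \<in> {1..n}" "\<not> (j \<in> A \<longleftrightarrow> j \<in> B)"
      using assms by blast
    then have "(\<Prod>j\<in>{1..n}. if j \<in> A \<longleftrightarrow> j \<in> B then 2 else 0 :: real) = 0"
      by (intro prod_zero) auto
    with False show ?thesis by simp
  qed simp
  finally show ?thesis
    by (simp add: cube_avg_def card_cube)
qed

lemma cube_avg_scaleR_left:
  "cube_avg n (\<lambda>\<epsilon>. g \<epsilon> *\<^sub>R x) = cube_avg n g *\<^sub>R x"
  by (simp add: cube_avg_def scaleR_sum_left[symmetric] divide_inverse mult.commute)

lemma cube_avg_sum:
  "cube_avg n (\<lambda>\<epsilon>. \<Sum>i\<in>I. g i \<epsilon>) = (\<Sum>i\<in>I. cube_avg n (g i))"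
  unfolding cube_avg_def scaleR_sum_right[symmetric] by (subst sum.swap) (rule refl)

lemma walsh_coeff_deriv:
  assumes "A \<subseteq> {1..n}"
  shows "walsh_coeff n (walsh_deriv n j f) A = (if j \<in> A then walsh_coeff n f A else 0)"
proof -
  have "walsh_coeff n (walsh_deriv n j f) A
      = cube_avg n (\<lambda>\<epsilon>. \<Sum>B\<in>Pow {1..n}.
          (walsh A \<epsilon> * walsh B \<epsilon>) *\<^sub>R (if j \<in> B then walsh_coeff n f B else 0))"
    unfolding walsh_coeff_def[of n "walsh_deriv n j f"] walsh_deriv_def scaleR_sum_right
    by (intro arg_cong[of _ _ "cube_avg n"] ext sum.cong) auto
  also have "\<dots> = (\<Sum>B\<in>Pow {1..n}. (if A = B then 1 else 0) *\<^sub>R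
                      (if j \<in> B then walsh_coeff n f B else 0))"
    unfolding cube_avg_sum cube_avg_scaleR_left
    by (intro sum.cong) (simp_all add: walsh_orthonormal assms del: One_nat_def)
  also have "\<dots> = (\<Sum>B\<in>Pow {1..n}. if A = B then (if j \<in> B then walsh_coeff n f B else 0) else 0)"
    by (intro sum.cong) auto
  also have "\<dots> = (if j \<in> A then walsh_coeff n f A else 0)"
    using assms by (subst sum.delta') auto
  finally show ?thesis .
qed

lemma walsh_derivs_Nil [simp]: "walsh_derivs n [] f = f"
  by (simp add: walsh_derivs_def)

lemma walsh_derivs_Cons [simp]:
  "walsh_derivs n (j # is) f = walsh_deriv n j (walsh_derivs n is f)"
  by (simp add: walsh_derivs_def)

lemma walsh_coeff_derivs_eq_0:
  assumes "A \<subseteq> {1..n}" "walsh_coeff n f A = 0"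
  shows "walsh_coeff n (walsh_derivs n is f) A = 0"
  by (induction "is") (simp_all add: assms(2) walsh_coeff_deriv[OF assms(1)])

section \<open>Coordinatewise Walsh analysis in \<open>\<ell>\<^sub>2\<^sup>M(X)\<close>\<close>

lemma coord_sum: "coord (\<Sum>s\<in>S. g s) m = (\<Sum>s\<in>S. coord (g s) m)"
  by (induction S rule: infinite_finite_induct) auto

lemma coord_walsh_coeff:
  "coord (walsh_coeff n F A) m = walsh_coeff n (\<lambda>\<epsilon>. coord (F \<epsilon>) m) A"
  by (simp add: walsh_coeff_def cube_avg_def coord_sum)

lemma coord_walsh_deriv:
  "coord (walsh_deriv n j F \<epsilon>) m = walsh_deriv n j (\<lambda>\<epsilon>. coord (F \<epsilon>) m) \<epsilon>"
  by (simp add: walsh_deriv_def coord_sum coord_walsh_coeff)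

lemma walsh_coeff_zero [simp]: "walsh_coeff n (\<lambda>\<epsilon>. 0) A = 0"
  by (simp add: walsh_coeff_def cube_avg_def)

lemma walsh_deriv_zero [simp]: "walsh_deriv n j (\<lambda>\<epsilon>. 0) \<epsilon> = 0"
  by (simp add: walsh_deriv_def)

section \<open>Iterating the gradient\<close>

lemma finite_words: "finite {is. length is = k \<and> set is \<subseteq> {1..n::nat}}"
  using finite_lists_length_eq[of "{1..n}" k] by (simp add: conj_commute)

lemma sum_words_Suc:
  fixes \<phi> :: "nat list \<Rightarrow> 'c::comm_monoid_add"
  shows "(\<Sum>is | length is = Suc k \<and> set is \<subseteq> {1..n}. \<phi> is)
       = (\<Sum>j=1..n. \<Sum>is | length is = k \<and> set is \<subseteq> {1..n}. \<phi> (j # is))"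
proof -
  have "(\<Sum>is | length is = Suc k \<and> set is \<subseteq> {1..n}. \<phi> is)
      = (\<Sum>(j, is)\<in>{1..n} \<times> {is. length is = k \<and> set is \<subseteq> {1..n}}. \<phi> (j # is))"
    by (rule sum.reindex_bij_witness[of _ "\<lambda>(j, is). j # is" "\<lambda>is. (hd is, tl is)"])
       (auto simp: length_Suc_conv)
  then show ?thesis
    by (simp add: sum.cartesian_product)
qed

lemma G_ord_0: "G_ord 0 n f \<epsilon> = norm (f \<epsilon>)"
proof -
  have "{is. length is = 0 \<and> set is \<subseteq> {1..n}} = {[]}"
    by auto
  then show ?thesis by (simp add: G_ord_def)
qed

lemma G_ord_1: "G_ord 1 n f \<epsilon> = sqrt (\<Sum>j=1..n. (norm (walsh_deriv n j f \<epsilon>))\<^sup>2)"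
proof -
  have "{is. length is = 0 \<and> set is \<subseteq> {1..n}} = {[]}"
    by auto
  then have "(\<Sum>is | length is = Suc 0 \<and> set is \<subseteq> {1..n}. (norm (walsh_derivs n is f \<epsilon>))\<^sup>2)
      = (\<Sum>j=1..n. (norm (walsh_deriv n j f \<epsilon>))\<^sup>2)"
    unfolding sum_words_Suc by (simp only: sum.insert sum.empty) simp
  then show ?thesis by (simp add: G_ord_def)
qed

lemma G_ord_nonneg [simp]: "0 \<le> G_ord k n f \<epsilon>"
  by (simp add: G_ord_def sum_nonneg)

lemma G_dis_nonneg [simp]: "0 \<le> G_dis k n f \<epsilon>"
  by (simp add: G_dis_def sum_nonneg)

lemma Lp_norm_nonneg: "0 \<le> Lp_norm p n f"
  by (simp add: Lp_norm_def)

lemma Lp_norm_mono: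
  assumes "0 < p" "\<And>\<epsilon>. norm (f \<epsilon>) \<le> norm (g \<epsilon>)"
  shows "Lp_norm p n f \<le> Lp_norm p n g"
  unfolding Lp_norm_def cube_avg_def using assms
  by (intro powr_mono2 scaleR_left_mono sum_mono scaleR_nonneg_nonneg sum_nonneg) auto

lemma Lp_norm_cong:
  assumes "\<And>\<epsilon>. norm (f \<epsilon>) = norm (g \<epsilon>)"
  shows "Lp_norm p n f = Lp_norm p n g"
  by (simp add: Lp_norm_def assms)

text \<open>
  This is the step that replaces a gradient of order \<open>k + 1\<close> by a gradient of order one: the
  witness \<open>F\<close> lists all derivatives of order \<open>k\<close>.  For \<open>k = 0\<close> it is \<open>f\<close> itself, placed in
  \<open>\<ell>\<^sub>2\<^sup>1(X)\<close>.
\<close>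

lemma ex_derivative_vector:
  fixes f :: "(nat \<Rightarrow> real) \<Rightarrow> 'a::real_normed_vector"
  assumes "n \<ge> 1" and f: "f \<in> walsh_poly d n UNIV"
  obtains M and F :: "(nat \<Rightarrow> real) \<Rightarrow> 'a l2fin" where "M \<ge> 1" "F \<in> walsh_poly d n (ell2 M)"
    and "\<And>\<epsilon>. norm (F \<epsilon>) = G_ord k n f \<epsilon>"
    and "\<And>\<epsilon>. G_ord 1 n F \<epsilon> = G_ord (Suc k) n f \<epsilon>"
proof -
  define W where "W = {is. length is = k \<and> set is \<subseteq> {1..n}}"
  define M where "M = card W"
  have "finite W"
    unfolding W_def by (rule finite_words)
  moreover have "replicate k 1 \<in> W"
    using \<open>n \<ge> 1\<close> by (auto simp: W_def)
  ultimately have "0 < card W"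
    unfolding card_gt_0_iff by blast
  then have "M \<ge> 1"
    by (simp add: M_def)
  obtain h where h: "bij_betw h {1..M} W"
    using ex_bij_betw_nat_finite_1[OF \<open>finite W\<close>] unfolding M_def by blast
  have reindex: "(\<Sum>m=1..M. \<phi> (h m)) = (\<Sum>is\<in>W. \<phi> is)" for \<phi> :: "nat list \<Rightarrow> real"
    using sum.reindex_bij_betw[OF h] .
  have "\<exists>F. \<forall>\<epsilon>. F \<epsilon> \<in> ell2 M \<and> (\<forall>m\<in>{1..M}. coord (F \<epsilon>) m = walsh_derivs n (h m) f \<epsilon>)"
    by (intro choice allI ex1_implies_ex[OF ex_ell2])
  then obtain F where F_ell2: "\<And>\<epsilon>. F \<epsilon> \<in> ell2 M"
    and F_coord: "\<And>\<epsilon> m. m \<in> {1..M} \<Longrightarrow> coord (F \<epsilon>) m = walsh_derivs n (h m) f \<epsilon>"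
    by blast
  have F_coord_0: "coord (F \<epsilon>) m = 0" if "m \<notin> {1..M}" for \<epsilon> m
    using F_ell2 that by (auto simp: ell2_def)

  have "walsh_coeff n F A = 0" if A: "A \<subseteq> {1..n}" "card A > d" for A
  proof (rule l2fin_eqI)
    fix m
    have "walsh_coeff n f A = 0"
      using f A by (auto simp: walsh_poly_def)
    then have "walsh_coeff n (walsh_derivs n (h m) f) A = 0"
      using A by (simp add: walsh_coeff_derivs_eq_0)
    then show "coord (walsh_coeff n F A) m = coord 0 m"
      by (cases "m \<in> {1..M}")
         (simp_all add: coord_walsh_coeff F_coord F_coord_0)
  qed
  with F_ell2 have "F \<in> walsh_poly d n (ell2 M)"
    by (auto simp: walsh_poly_def)
  moreover have "norm (F \<epsilon>) = G_ord k n f \<epsilon>" for \<epsilon>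
  proof -
    have "norm (F \<epsilon>) = sqrt (\<Sum>m=1..M. (norm (walsh_derivs n (h m) f \<epsilon>))\<^sup>2)"
      by (simp add: norm_ell2[OF F_ell2] F_coord)
    then show ?thesis
      unfolding reindex[of "\<lambda>is. (norm (walsh_derivs n is f \<epsilon>))\<^sup>2"] by (simp add: G_ord_def W_def)
  qed
  moreover have "G_ord 1 n F \<epsilon> = G_ord (Suc k) n f \<epsilon>" for \<epsilon>
  proof -
    have "(norm (walsh_deriv n j F \<epsilon>))\<^sup>2 = (\<Sum>is\<in>W. (norm (walsh_derivs n (j # is) f \<epsilon>))\<^sup>2)" for j
    proof -
      have "walsh_deriv n j F \<epsilon> \<in> ell2 M"
        by (simp add: ell2_def coord_walsh_deriv F_coord_0 del: atLeastAtMost_iff)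
      then have "(norm (walsh_deriv n j F \<epsilon>))\<^sup>2
          = (\<Sum>m=1..M. (norm (walsh_derivs n (j # h m) f \<epsilon>))\<^sup>2)"
        by (simp add: norm_ell2 sum_nonneg coord_walsh_deriv F_coord)
      then show ?thesis
        unfolding reindex[of "\<lambda>is. (norm (walsh_derivs n (j # is) f \<epsilon>))\<^sup>2"] .
    qed
    then show ?thesis
      unfolding G_ord_1 G_ord_def[of "Suc k"] sum_words_Suc W_def by simp
  qed
  ultimately show thesis
    using that \<open>M \<ge> 1\<close> by blast
qed

text \<open>
  The ratio \<open>c\<close> may have any sign: if it is negative, then \<open>0 \<le> N (k + 1) \<le> c * N k\<close> forces
  \<open>N k = 0\<close> for every \<open>k\<close>.
\<close>

lemma geometric_bound:
  fixes N :: "nat \<Rightarrow> real"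
  assumes nonneg: "\<And>k. 0 \<le> N k" and step: "\<And>k. N (Suc k) \<le> c * N k"
  shows "N k \<le> c ^ k * N 0"
proof (cases "c \<ge> 0")
  case True
  show ?thesis
  proof (induction k)
    case (Suc k)
    have "N (Suc k) \<le> c * N k" by (rule step)
    also have "\<dots> \<le> c * (c ^ k * N 0)" using Suc True by (rule mult_left_mono)
    finally show ?case by (simp add: mult.assoc)
  qed simp
next
  case False
  have "N k = 0" for k
  proof -
    have "0 \<le> c * N k"
      using nonneg[of "Suc k"] step[of k] by linarith
    with False nonneg[of k] show ?thesis
      by (simp add: zero_le_mult_iff)
  qed
  then show ?thesis by simp
qed

lemma G_dis_le_G_ord: "G_dis k n f \<epsilon> \<le> G_ord k n f \<epsilon>"
proof -
  let ?S = "{A. A \<subseteq> {1..n} \<and> card A = k}"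
  have set_sorted: "set (sorted_list_of_set A) = A" if "A \<in> ?S" for A
    using that by (intro set_sorted_list_of_set) (auto intro: finite_subset)
  then have "inj_on sorted_list_of_set ?S"
    by (rule inj_on_inverseI[where g = set])
  then have "(\<Sum>A\<in>?S. (norm (walsh_deriv_set n A f \<epsilon>))\<^sup>2)
      = (\<Sum>is\<in>sorted_list_of_set ` ?S. (norm (walsh_derivs n is f \<epsilon>))\<^sup>2)"
    by (simp add: walsh_deriv_set_def sum.reindex)
  also have "\<dots> \<le> (\<Sum>is | length is = k \<and> set is \<subseteq> {1..n}. (norm (walsh_derivs n is f \<epsilon>))\<^sup>2)"
  proof (rule sum_mono2)
    show "sorted_list_of_set ` ?S \<subseteq> {is. length is = k \<and> set is \<subseteq> {1..n}}"
    proof clarify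
      fix A assume "A \<subseteq> {1..n}" "k = card A"
      then show "length (sorted_list_of_set A) = card A \<and> set (sorted_list_of_set A) \<subseteq> {1..n}"
        using set_sorted[of A] by simp
    qed
  qed (rule finite_words, simp)
  finally show ?thesis
    by (simp add: G_dis_def G_ord_def)
qed

theorem theorem5p4:
  fixes p a C :: real
  assumes "1 < p" and "a \<ge> 0"
    and "\<And>(M::nat) (n::nat) (d::nat) (F :: (nat \<Rightarrow> real) \<Rightarrow> 'a::banach l2fin).
           M \<ge> 1 \<Longrightarrow> n \<ge> 1 \<Longrightarrow> d \<ge> 1 \<Longrightarrow> F \<in> walsh_poly d n (ell2 M) \<Longrightarrow>
           Lp_norm p n (G_ord 1 n F) \<le> C * real d powr a * Lp_norm p n F"
  shows "\<forall>k\<ge>1. \<forall>n\<ge>1. \<forall>d\<ge>1. \<forall>f \<in> walsh_poly d n (UNIV :: 'a set).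
           Lp_norm p n (G_ord k n f) \<le> C ^ k * real d powr (real k * a) * Lp_norm p n f \<and>
           Lp_norm p n (G_dis k n f) \<le> C ^ k * real d powr (real k * a) * Lp_norm p n f"
proof (intro allI impI ballI)
  fix k n d :: nat and f :: "(nat \<Rightarrow> real) \<Rightarrow> 'a"
  assume n: "1 \<le> n" and d: "1 \<le> d" and f: "f \<in> walsh_poly d n UNIV"
  define N where "N l = Lp_norm p n (G_ord l n f)" for l
  have "N (Suc l) \<le> (C * real d powr a) * N l" for l
  proof -
    obtain M and F :: "(nat \<Rightarrow> real) \<Rightarrow> 'a l2fin" where F: "M \<ge> 1" "F \<in> walsh_poly d n (ell2 M)"
      and norm_F: "\<And>\<epsilon>. norm (F \<epsilon>) = G_ord l n f \<epsilon>"
      and grad_F: "\<And>\<epsilon>. G_ord 1 n F \<epsilon> = G_ord (Suc l) n f \<epsilon>"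
      using ex_derivative_vector[OF n f, where k = l] by blast
    have "Lp_norm p n F = N l"
      unfolding N_def by (rule Lp_norm_cong) (simp add: norm_F)
    moreover have "Lp_norm p n (G_ord 1 n F) = N (Suc l)"
      unfolding N_def by (rule Lp_norm_cong) (simp only: grad_F)
    ultimately show ?thesis
      using assms(3)[OF F(1) n d F(2)] by simp
  qed
  then have "N k \<le> (C * real d powr a) ^ k * N 0"
    by (intro geometric_bound) (simp_all add: N_def Lp_norm_nonneg)
  moreover have "N 0 = Lp_norm p n f"
    unfolding N_def by (rule Lp_norm_cong) (simp add: G_ord_0)
  moreover have "(C * real d powr a) ^ k = C ^ k * real d powr (real k * a)"
    using d by (simp add: power_mult_distrib powr_power mult.commute)
  moreover have "Lp_norm p n (G_dis k n f) \<le> N k"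
    unfolding N_def using \<open>1 < p\<close> by (intro Lp_norm_mono) (simp_all add: G_dis_le_G_ord)
  ultimately show "Lp_norm p n (G_ord k n f) \<le> C ^ k * real d powr (real k * a) * Lp_norm p n f \<and>
      Lp_norm p n (G_dis k n f) \<le> C ^ k * real d powr (real k * a) * Lp_norm p n f"
    by (simp add: N_def)
qed

end
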